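(* Let $E\in\mathcal{F}^{n,n}$ be the mass matrix of a parameter-dependent port-Hamiltonian system $$E(\mu)\dot{x}=(J(\mu)-R(\mu))x+(B(\mu)-P(\mu))u,\qquad y=(B(\mu)+P(\mu))^\top x+(S(\mu)+N(\mu))u$$ (port-Hamiltonian with $Q=I_n$ for almost all $\mu\in\mathcal{M}$), with Hamiltonian function $H(x,\mu)=\tfrac12 x^\top E(\mu)^\top x$ for $x\in\mathbb{R}^n$. Let $s\ge1$, $\hat{E}=\mathscr{G}_s(E)$, and let $\hat{H}(\hat{v})=\tfrac12\hat{v}^\top\hat{E}\hat{v}$ be the Hamiltonian function of the associated stochastic Galerkin system. Then for all $\hat{v}=(\hat{v}_1^\top,\dots,\hat{v}_s^\top)^\top\in\mathbb{R}^{sn}$ with $\hat{v}_1,\dots,\hat{v}_s\in\mathbb{R}^n$, $$\hat{H}(\hat{v})=\mathbb{E}\Bigl[H\Bigl(\sum_{j=1}^s\hat{v}_j\Phi_j(\mu),\mu\Bigr)\Bigr].$$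
   Context: **Port-Hamiltonian (pH) system.** $\mathcal{S}^n_{\succeq}$ denotes the set of real symmetric positive semi-definite $n\times n$ matrices. A linear first-order pH system has the form $$E\dot{x}=(J-R)Qx+(B-P)u,\qquad y=(B+P)^\top Qx+(S+N)u$$ with $E,J,R,Q\in\mathbb{R}^{n\times n}$, $B,P\in\mathbb{R}^{n\times m}$, $S,N\in\mathbb{R}^{m\times m}$ such that $J$ and $N$ are skew-symmetric, $E^\top Q\in\mathcal{S}^n_{\succeq}$, and $$\begin{pmatrix}Q^\top RQ & Q^\top P\\ P^\top Q & S\end{pmatrix}\in\mathcal{S}^{n+m}_{\succeq}.$$ Its Hamiltonian function is $H(x)=\tfrac12x^\top(E^\top Q)x$. **Stochastic setting.** The parameters $\mu\in\mathcal{M}\subseteq\mathbb{R}^q$ are independent random variables with joint probability density $\rho:\mathcal{M}\to\mathbb{R}$. Expected values are $\mathbb{E}[f]=\int_{\mathcal{M}}f(\mu)\rho(\mu)\,\mathrm{d}\mu$, and $\langle f,g\rangle=\mathbb{E}[fg]$ is the inner product on $\mathcal{L}^2(\mathcal{M},\rho)=\{f:\mathcal{M}\to\mathbb{R}\text{ measurable}:\mathbb{E}[f^2]<\infty\}$. $(\Phi_i)_{i\in\mathbb{N}}$ is an orthonormal basis of $\mathcal{L}^2(\mathcal{M},\rho)$ consisting of polynomials, with $\Phi_1\equiv 1$. **Stochastic Galerkin projection.** $\mathcal{F}^{n,m}$ is the set of all measurable $A=(a_{k\ell}):\mathcal{M}\to\mathbb{R}^{n\times m}$ such that $\hat{a}_{ijk\ell}=\mathbb{E}[a_{k\ell}\Phi_i\Phi_j]$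 is finite (i.e., the integral exists and is finite) for all $i,j\in\mathbb{N}$, $1\le k\le n$, $1\le\ell\le m$. For $A\in\mathcal{F}^{n,m}$ and $s\ge1$, $\mathscr{G}_s(A)\in\mathbb{R}^{ns\times ms}$ is the block matrix $(\hat{A}_{ij})_{i,j=1,\dots,s}$ with blocks $\hat{A}_{ij}=(\hat{a}_{ijk\ell})_{k,\ell}\in\mathbb{R}^{n\times m}$. The stochastic Galerkin system is the pH system (with $\hat{Q}=I_{ns}$) whose matrices are the images under $\mathscr{G}_s$ of the matrices of the parameter-dependent system; in particular its mass matrix is $\hat{E}=\mathscr{G}_s(E)$. *)

theory Defs
  imports "HOL-Probability.Probability" "Jordan_Normal_Form.Matrix"
begin

text \<open>
  Vectors and matrices of the systems are those of \<^theory>\<open>Jordan_Normal_Form.Matrix\<close>, since the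
  Galerkin matrices have size \<open>n * s\<close> with \<open>s\<close> a variable. The parameter space is the type
  \<open>real^'q\<close>. All indices, including that of the basis functions, start at \<open>0\<close>: \<open>\<Phi> i\<close> is
  the function written \<open>\<Phi>\<close> with index \<open>i + 1\<close> in the usual numbering.
\<close>

subsection \<open>Port-Hamiltonian systems\<close>

definition sym_psd :: "nat \<Rightarrow> real mat \<Rightarrow> bool" where
  "sym_psd n A \<longleftrightarrow> A \<in> carrier_mat n n \<and> transpose_mat A = A \<and>
     (\<forall>x \<in> carrier_vec n. 0 \<le> scalar_prod x (A *\<^sub>v x))"

definition skew_sym :: "nat \<Rightarrow> real mat \<Rightarrow> bool" where
  "skew_sym n A \<longleftrightarrow> A \<in> carrier_mat n n \<and> transpose_mat A = - A"

definition port_Hamiltonian ::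
  "nat \<Rightarrow> nat \<Rightarrow> real mat \<Rightarrow> real mat \<Rightarrow> real mat \<Rightarrow> real mat \<Rightarrow>
   real mat \<Rightarrow> real mat \<Rightarrow> real mat \<Rightarrow> real mat \<Rightarrow> bool" where
  "port_Hamiltonian n m E J R Q B P S N \<longleftrightarrow>
     E \<in> carrier_mat n n \<and> J \<in> carrier_mat n n \<and> R \<in> carrier_mat n n \<and> Q \<in> carrier_mat n n \<and>
     B \<in> carrier_mat n m \<and> P \<in> carrier_mat n m \<and> S \<in> carrier_mat m m \<and> N \<in> carrier_mat m m \<and>
     skew_sym n J \<and> skew_sym m N \<and>
     sym_psd n (transpose_mat E * Q) \<and>
     sym_psd (n + m)
       (four_block_mat (transpose_mat Q * R * Q) (transpose_mat Q * P)
                       (transpose_mat P * Q)     S)"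

subsection \<open>Random parameters\<close>

definition param_measure :: "(real^'q) set \<Rightarrow> (real^'q \<Rightarrow> real) \<Rightarrow> (real^'q) measure" where
  "param_measure M \<rho> = density (lebesgue_on M) (\<lambda>\<mu>. ennreal (\<rho> \<mu>))"

definition joint_density :: "(real^'q) set \<Rightarrow> (real^'q \<Rightarrow> real) \<Rightarrow> bool" where
  "joint_density M \<rho> \<longleftrightarrow>
     M \<in> sets lebesgue \<and> \<rho> \<in> borel_measurable (lebesgue_on M) \<and> (\<forall>\<mu>\<in>M. 0 \<le> \<rho> \<mu>) \<and>
     prob_space (param_measure M \<rho>)"

definition indep_params :: "(real^'q) set \<Rightarrow> (real^'q \<Rightarrow> real) \<Rightarrow> bool" where
  "indep_params M \<rho> \<longleftrightarrow>
     prob_space.indep_vars (param_measure M \<rho>) (\<lambda>_. borel) (\<lambda>i \<mu>. vec_nth \<mu> i) UNIV"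

definition has_expectation :: "(real^'q) set \<Rightarrow> (real^'q \<Rightarrow> real) \<Rightarrow> (real^'q \<Rightarrow> real) \<Rightarrow> bool" where
  "has_expectation M \<rho> f \<longleftrightarrow> integrable (lebesgue_on M) (\<lambda>\<mu>. f \<mu> * \<rho> \<mu>)"

definition expected :: "(real^'q) set \<Rightarrow> (real^'q \<Rightarrow> real) \<Rightarrow> (real^'q \<Rightarrow> real) \<Rightarrow> real" where
  "expected M \<rho> f = (LINT \<mu>|lebesgue_on M. f \<mu> * \<rho> \<mu>)"

definition L2 :: "(real^'q) set \<Rightarrow> (real^'q \<Rightarrow> real) \<Rightarrow> (real^'q \<Rightarrow> real) set" where
  "L2 M \<rho> = {f. f \<in> borel_measurable (lebesgue_on M) \<and> has_expectation M \<rho> (\<lambda>\<mu>. (f \<mu>)\<^sup>2)}"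

text \<open>The last conjunct is completeness: every element of \<open>L2\<close> is the sum of a series in the
  \<open>\<Phi> i\<close> that converges in the \<open>L2\<close> norm.\<close>

definition orthonormal_basis :: "(real^'q) set \<Rightarrow> (real^'q \<Rightarrow> real) \<Rightarrow> (nat \<Rightarrow> real^'q \<Rightarrow> real) \<Rightarrow> bool" where
  "orthonormal_basis M \<rho> \<Phi> \<longleftrightarrow>
     (\<forall>i. \<Phi> i \<in> L2 M \<rho>) \<and>
     (\<forall>i j. expected M \<rho> (\<lambda>\<mu>. \<Phi> i \<mu> * \<Phi> j \<mu>) = (if i = j then 1 else 0)) \<and>
     (\<forall>f \<in> L2 M \<rho>. \<exists>c::nat \<Rightarrow> real.
        (\<lambda>k. expected M \<rho> (\<lambda>\<mu>. (f \<mu> - (\<Sum>i<k. c i * \<Phi> i \<mu>))\<^sup>2)) \<longlonglongrightarrow> 0)"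

definition polynomial_basis :: "(real^'q) set \<Rightarrow> (real^'q \<Rightarrow> real) \<Rightarrow> (nat \<Rightarrow> real^'q \<Rightarrow> real) \<Rightarrow> bool" where
  "polynomial_basis M \<rho> \<Phi> \<longleftrightarrow>
     orthonormal_basis M \<rho> \<Phi> \<and>
     (\<forall>i. \<exists>p. real_polynomial_function p \<and> (\<forall>\<mu>\<in>M. \<Phi> i \<mu> = p \<mu>)) \<and>
     (\<forall>\<mu>\<in>M. \<Phi> 0 \<mu> = 1)"

subsection \<open>Stochastic Galerkin projection\<close>

definition galerkin_class ::
  "(real^'q) set \<Rightarrow> (real^'q \<Rightarrow> real) \<Rightarrow> (nat \<Rightarrow> real^'q \<Rightarrow> real) \<Rightarrow> nat \<Rightarrow> nat \<Rightarrow> (real^'q \<Rightarrow> real mat) set" where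
  "galerkin_class M \<rho> \<Phi> n m = {A.
     (\<forall>\<mu>\<in>M. A \<mu> \<in> carrier_mat n m) \<and>
     (\<forall>k<n. \<forall>l<m.
        (\<lambda>\<mu>. A \<mu> $$ (k, l)) \<in> borel_measurable (lebesgue_on M) \<and>
        (\<forall>i j. has_expectation M \<rho> (\<lambda>\<mu>. A \<mu> $$ (k, l) * \<Phi> i \<mu> * \<Phi> j \<mu>)))}"

text \<open>Row \<open>a\<close> of the block matrix is row \<open>a mod n\<close> of block row \<open>a div n\<close>, and likewise for
  the columns.\<close>

definition galerkin ::
  "(real^'q) set \<Rightarrow> (real^'q \<Rightarrow> real) \<Rightarrow> (nat \<Rightarrow> real^'q \<Rightarrow> real) \<Rightarrow> nat \<Rightarrow> nat \<Rightarrow> nat \<Rightarrow>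
   (real^'q \<Rightarrow> real mat) \<Rightarrow> real mat" where
  "galerkin M \<rho> \<Phi> n m s A =
     Matrix.mat (n * s) (m * s) (\<lambda>(a, b).
       expected M \<rho> (\<lambda>\<mu>. A \<mu> $$ (a mod n, b mod m) * \<Phi> (a div n) \<mu> * \<Phi> (b div m) \<mu>))"

definition stack_vec :: "nat \<Rightarrow> nat \<Rightarrow> (nat \<Rightarrow> real Matrix.vec) \<Rightarrow> real Matrix.vec" where
  "stack_vec n s v = Matrix.vec (n * s) (\<lambda>a. vec_index (v (a div n)) (a mod n))"

definition lin_comb :: "nat \<Rightarrow> nat \<Rightarrow> (nat \<Rightarrow> real Matrix.vec) \<Rightarrow> (nat \<Rightarrow> real) \<Rightarrow> real Matrix.vec" where
  "lin_comb n s v c = Matrix.vec n (\<lambda>k. \<Sum>j<s. vec_index (v j) k * c j)"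

end

theory Submission
  imports Defs
begin

text \<open>For fixed \<mu> in \<open>M\<close>, the Hamiltonian at the linear combination of the
  \<open>v j\<close> is a finite quadratic form in the entries of the stacked vector: its
  coefficients are the products of an entry of \<open>E \<mu>\<close> with two basis functions
  (\<open>quadratic_form_lin_comb\<close>). Each such product has an expectation because
  \<open>E\<close> lies in the Galerkin class, and that expectation is by definition an entry of
  \<open>Ehat\<close>. Linearity of the integral over the finite double sum therefore gives both the
  existence of the expected Hamiltonian and its value. The transpose in \<open>H\<close> is
  harmless, since a matrix and its transpose have the same quadratic form
  (\<open>quadratic_form_transpose\<close>).\<close>

text \<open>Cut the range into \<open>s\<close> consecutive intervals of length \<open>n\<close>: on
  the \<open>i\<close>-th one the quotient is \<open>i\<close> and the remainder runs through all
  residues. This converts flat indices of stacked vectors into pairs of block and position.\<close>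

lemma sum_div_mod:
  fixes f :: "nat \<Rightarrow> nat \<Rightarrow> 'a::comm_monoid_add"
  shows "(\<Sum>a<n * s. f (a div n) (a mod n)) = (\<Sum>i<s. \<Sum>k<n. f i k)"
proof (cases "n = 0")
  case False
  have "(\<Sum>a<n * s. f (a div n) (a mod n)) =
      (\<Sum>i<s. \<Sum>a = i * n..<i * n + n. f (a div n) (a mod n))"
    by (simp add: sum.nat_group mult.commute)
  also have "\<dots> = (\<Sum>i<s. \<Sum>k<n. f i k)"
  proof (rule sum.cong[OF refl])
    fix i
    have "(\<Sum>a = i * n..<i * n + n. f (a div n) (a mod n)) =
        (\<Sum>k<n. f ((k + i * n) div n) ((k + i * n) mod n))"
      using sum.shift_bounds_nat_ivl[of "\<lambda>a. f (a div n) (a mod n)" 0 "i * n" n]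
      by (simp add: atLeast0LessThan add.commute)
    also have "\<dots> = (\<Sum>k<n. f i k)"
      by (intro sum.cong) auto
    finally show "(\<Sum>a = i * n..<i * n + n. f (a div n) (a mod n)) = (\<Sum>k<n. f i k)" .
  qed
  finally show ?thesis .
qed simp

lemma quadratic_form_sum:
  fixes A :: "'a::comm_semiring_0 mat"
  assumes "A \<in> carrier_mat n n" "x \<in> carrier_vec n"
  shows "scalar_prod x (A *\<^sub>v x) = (\<Sum>k<n. \<Sum>l<n. A $$ (k, l) * vec_index x k * vec_index x l)"
  using assms
  by (auto simp: scalar_prod_def sum_distrib_left atLeast0LessThan ac_simps intro!: sum.cong)

lemma quadratic_form_transpose:
  fixes A :: "'a::comm_semiring_0 mat"
  assumes "A \<in> carrier_mat n n" "x \<in> carrier_vec n"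
  shows "scalar_prod x (transpose_mat A *\<^sub>v x) = scalar_prod x (A *\<^sub>v x)"
proof -
  have "scalar_prod x (transpose_mat A *\<^sub>v x) =
      (\<Sum>k<n. \<Sum>l<n. A $$ (l, k) * vec_index x k * vec_index x l)"
    using assms by (subst quadratic_form_sum[of _ n]) auto
  also have "\<dots> = scalar_prod x (A *\<^sub>v x)"
    using assms by (subst sum.swap) (simp add: quadratic_form_sum ac_simps)
  finally show ?thesis .
qed

text \<open>The pointwise core: with \<open>c j\<close> equal to \<open>\<Phi> j \<mu>\<close>, the
  parenthesised factor is the integrand, up to the density, of entry \<open>(a, b)\<close> of the
  Galerkin matrix, and what stands before it is independent of \<mu>.\<close>

lemma quadratic_form_lin_comb:
  assumes A: "A \<in> carrier_mat n n"
  shows "scalar_prod (lin_comb n s v c) (A *\<^sub>v lin_comb n s v c) =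
    (\<Sum>a<n * s. \<Sum>b<n * s. vec_index (stack_vec n s v) a * vec_index (stack_vec n s v) b *
       (A $$ (a mod n, b mod n) * c (a div n) * c (b div n)))"
proof -
  define V where "V i k = vec_index (v i) k" for i k
  have "(\<Sum>a<n * s. \<Sum>b<n * s. vec_index (stack_vec n s v) a * vec_index (stack_vec n s v) b *
       (A $$ (a mod n, b mod n) * c (a div n) * c (b div n))) =
     (\<Sum>a<n * s. \<Sum>b<n * s. V (a div n) (a mod n) * V (b div n) (b mod n) *
       (A $$ (a mod n, b mod n) * c (a div n) * c (b div n)))"
    by (intro sum.cong) (auto simp: stack_vec_def V_def)
  also have "\<dots> = (\<Sum>a<n * s. \<Sum>j<s. \<Sum>l<n. V (a div n) (a mod n) * V j l *
       (A $$ (a mod n, l) * c (a div n) * c j))"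
    by (intro sum.cong refl sum_div_mod)
  also have "\<dots> = (\<Sum>i<s. \<Sum>k<n. \<Sum>j<s. \<Sum>l<n. V i k * V j l * (A $$ (k, l) * c i * c j))"
    by (rule sum_div_mod)
  \<comment> \<open>The block sums over \<open>i\<close> and \<open>j\<close> are moved inside, so
    that for fixed \<open>k\<close> and \<open>l\<close> they factor into the components
    \<open>k\<close> and \<open>l\<close> of the linear combination.\<close>
  also have "\<dots> = (\<Sum>k<n. \<Sum>i<s. \<Sum>l<n. \<Sum>j<s. V i k * V j l * (A $$ (k, l) * c i * c j))"
    by (subst sum.swap) (intro sum.cong refl sum.swap)
  also have "\<dots> = (\<Sum>k<n. \<Sum>l<n. \<Sum>i<s. \<Sum>j<s. V i k * V j l * (A $$ (k, l) * c i * c j))"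
    by (intro sum.cong refl sum.swap)
  also have "\<dots> = (\<Sum>k<n. \<Sum>l<n. A $$ (k, l) * (\<Sum>i<s. V i k * c i) * (\<Sum>j<s. V j l * c j))"
    by (simp only: mult.assoc sum_product) (simp only: sum_distrib_left ac_simps)
  also have "\<dots> = scalar_prod (lin_comb n s v c) (A *\<^sub>v lin_comb n s v c)"
    by (subst quadratic_form_sum[OF A]) (auto simp: lin_comb_def V_def intro!: sum.cong)
  finally show ?thesis by simp
qed

theorem theorem4p5:
  fixes M :: "(real^'q) set" and \<rho> :: "real^'q \<Rightarrow> real"
    and \<Phi> :: "nat \<Rightarrow> real^'q \<Rightarrow> real"
    and E J R B P S N :: "real^'q \<Rightarrow> real mat"
    and H :: "real Matrix.vec \<Rightarrow> real^'q \<Rightarrow> real"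
    and Ehat :: "real mat" and Hhat :: "real Matrix.vec \<Rightarrow> real"
    and n m s :: nat and v :: "nat \<Rightarrow> real Matrix.vec"
  defines "H \<equiv> \<lambda>x \<mu>. 1 / 2 * scalar_prod x (transpose_mat (E \<mu>) *\<^sub>v x)"
    and "Ehat \<equiv> galerkin M \<rho> \<Phi> n n s E"
    and "Hhat \<equiv> \<lambda>w. 1 / 2 * scalar_prod w (Ehat *\<^sub>v w)"
  assumes "joint_density M \<rho>"
    and "indep_params M \<rho>"
    and "polynomial_basis M \<rho> \<Phi>"
    and "E \<in> galerkin_class M \<rho> \<Phi> n n"
    and "AE \<mu> in param_measure M \<rho>.
           port_Hamiltonian n m (E \<mu>) (J \<mu>) (R \<mu>) (1\<^sub>m n) (B \<mu>) (P \<mu>) (S \<mu>) (N \<mu>)"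
    and "s \<ge> 1"
    and "\<forall>j<s. v j \<in> carrier_vec n"
  shows "has_expectation M \<rho> (\<lambda>\<mu>. H (lin_comb n s v (\<lambda>j. \<Phi> j \<mu>)) \<mu>) \<and>
         Hhat (stack_vec n s v) =
           expected M \<rho> (\<lambda>\<mu>. H (lin_comb n s v (\<lambda>j. \<Phi> j \<mu>)) \<mu>)"
proof -
  define w where "w = stack_vec n s v"
  define G where "G a b \<mu> = E \<mu> $$ (a mod n, b mod n) * \<Phi> (a div n) \<mu> * \<Phi> (b div n) \<mu>" for a b \<mu>
  have carrier: "E \<mu> \<in> carrier_mat n n" if "\<mu> \<in> M" for \<mu>
    using assms(7) that by (auto simp: galerkin_class_def)
  have G_int: "integrable (lebesgue_on M) (\<lambda>\<mu>. G a b \<mu> * \<rho> \<mu>)" if "a < n * s" "b < n * s" for a b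
  proof -
    \<comment> \<open>Remainders modulo \<open>n\<close> are valid matrix indices only for positive
      \<open>n\<close>; for \<open>n = 0\<close> no index \<open>a\<close> exists.\<close>
    have "0 < n"
      using that by (cases n) auto
    then show ?thesis
      using assms(7) by (auto simp: galerkin_class_def has_expectation_def G_def)
  qed
  \<comment> \<open>The dimension of \<open>E \<mu>\<close> is known only on \<open>M\<close>, which
    is the whole space of \<open>lebesgue_on M\<close>; hence the identity there suffices under the
    integral.\<close>
  have H_eq: "H (lin_comb n s v (\<lambda>j. \<Phi> j \<mu>)) \<mu> * \<rho> \<mu> =
      1 / 2 * (\<Sum>a<n * s. \<Sum>b<n * s. vec_index w a * vec_index w b * (G a b \<mu> * \<rho> \<mu>))"
    if "\<mu> \<in> M" for \<mu>
  proof -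
    have "lin_comb n s v c \<in> carrier_vec n" for c
      by (simp add: lin_comb_def)
    then show ?thesis
      using carrier[OF that]
      by (simp add: H_def quadratic_form_transpose quadratic_form_lin_comb w_def G_def
          sum_distrib_right mult.assoc)
  qed
  \<comment> \<open>This form yields integrability and the value of the integral together, hence
    both conjuncts of the claim.\<close>
  have has_int: "has_bochner_integral (lebesgue_on M)
      (\<lambda>\<mu>. H (lin_comb n s v (\<lambda>j. \<Phi> j \<mu>)) \<mu> * \<rho> \<mu>)
      (1 / 2 * (\<Sum>a<n * s. \<Sum>b<n * s. vec_index w a * vec_index w b * expected M \<rho> (G a b)))"
  proof (subst has_bochner_integral_cong[OF refl H_eq refl])
    show "has_bochner_integral (lebesgue_on M)
      (\<lambda>\<mu>. 1 / 2 * (\<Sum>a<n * s. \<Sum>b<n * s. vec_index w a * vec_index w b * (G a b \<mu> * \<rho> \<mu>)))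
      (1 / 2 * (\<Sum>a<n * s. \<Sum>b<n * s. vec_index w a * vec_index w b * expected M \<rho> (G a b)))"
      using G_int unfolding expected_def
      by (intro has_bochner_integral_mult_right has_bochner_integral_sum
          has_bochner_integral_integrable) auto
  qed simp
  have "Ehat \<in> carrier_mat (n * s) (n * s)" "w \<in> carrier_vec (n * s)"
    by (simp_all add: Ehat_def galerkin_def w_def stack_vec_def)
  then have "Hhat w = 1 / 2 *
      (\<Sum>a<n * s. \<Sum>b<n * s. vec_index w a * vec_index w b * expected M \<rho> (G a b))"
    by (simp add: Hhat_def quadratic_form_sum)
       (auto simp: Ehat_def galerkin_def G_def[abs_def] ac_simps intro!: sum.cong)
  with has_int show ?thesis
    unfolding has_expectation_def expected_def w_def
    by (auto simp: has_bochner_integral_iff)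
qed

end
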